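(* Let $S=\langle L,\leq,\top,\bot,\Box,\boxtimes\rangle$ be an abstract provability structure and let $\triangle v$ be a one-variable APS term of the form $\boxtimes\Box^{k_1}\boxtimes\Box^{k_2}\cdots\boxtimes\Box^{k_n}v$, where $n\geq 1$ and $k_1,\dots,k_n$ are natural numbers. Let $k=\min\{k_1,k_2,\ldots,k_n\}$. Suppose that $\mathsf{E}_S(\boxtimes\Box^k)$ holds. Then $\mathsf{E}_S(\triangle)$ and $\mathsf{U}_S(\triangle)$ hold. Furthermore, $\boxtimes\top$ is the unique fixed point of $\triangle v$ in $S$.
   Context: An abstract provability structure (APS) is a tuple $S=\langle L,\leq,\top,\bot,\Box,\boxtimes\rangle$ where $L$ is a nonempty set, $\leq$ is a partial order on $L$, $\top,\bot\in L$, and $\Box,\boxtimes$ are unary operations on $L$ such that for all $x,y\in L$: (C1) if $x\leq y$ then $\Box x\leq\Box y$ and $\boxtimes y\leq\boxtimes x$; (C2) $\top\leq\boxtimes\bot$; (C3) if $x\leq\Box y$ and $x\leq\boxtimes y$ then $x\leq\boxtimes\top$; (C4) $\boxtimes x\leq\Box\boxtimes x$; (C5) $x\leq\top$. (It is not assumed that $\bot$ is the least element.) A one-variable APS term $\triangle v$ is generated from the variable $v$ by finitely many applications of $\Box$ and $\boxtimes$; it induces a unary operation $x\mapsto\triangle x$ on $L$. Compositions are written by concatenation, and $\Box^n$ is the $n$-fold iterate of $\Box$. Natural numbers include $0$. A fixed point of $\triangle v$ in $S$ is an element $p\in L$ with $\triangle p=p$. $\mathsf{E}_S(\triangle)$ means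 "$\triangle v$ has a fixed point in $S$"; $\mathsf{U}_S(\triangle)$ means "$\triangle v$ has at most one fixed point in $S$". *)

theory Defs
  imports Main
begin

record 'a aps_sig =
  carrier :: "'a set"
  le :: "'a \<Rightarrow> 'a \<Rightarrow> bool"  (infix "\<sqsubseteq>\<index>" 50)
  tp :: 'a  (\<open>\<top>\<index>\<close>)
  bt :: 'a  (\<open>\<bottom>\<index>\<close>)
  box :: "'a \<Rightarrow> 'a"  (\<open>\<box>\<index> _\<close> [81] 80)
  xbox :: "'a \<Rightarrow> 'a"  (\<open>\<boxtimes>\<index> _\<close> [81] 80)

text \<open>Only the restriction of \<open>le\<close> and of the operations to the carrier matters.
  The element \<open>bt\<close> is not assumed to be least.\<close>

locale aps =
  fixes S :: "'a aps_sig" (structure)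
  assumes nonempty: "carrier S \<noteq> {}"
    and le_refl: "reflp_on (carrier S) (le S)"
    and le_trans: "transp_on (carrier S) (le S)"
    and le_antisym: "antisymp_on (carrier S) (le S)"
    and top_closed: "\<top> \<in> carrier S"
    and bot_closed: "\<bottom> \<in> carrier S"
    and box_closed: "x \<in> carrier S \<Longrightarrow> \<box> x \<in> carrier S"
    and xbox_closed: "x \<in> carrier S \<Longrightarrow> \<boxtimes> x \<in> carrier S"
    and C1_box: "\<lbrakk>x \<in> carrier S; y \<in> carrier S; x \<sqsubseteq> y\<rbrakk> \<Longrightarrow> \<box> x \<sqsubseteq> \<box> y"
    and C1_xbox: "\<lbrakk>x \<in> carrier S; y \<in> carrier S; x \<sqsubseteq> y\<rbrakk> \<Longrightarrow> \<boxtimes> y \<sqsubseteq> \<boxtimes> x"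
    and C2: "\<top> \<sqsubseteq> \<boxtimes> \<bottom>"
    and C3: "\<lbrakk>x \<in> carrier S; y \<in> carrier S; x \<sqsubseteq> \<box> y; x \<sqsubseteq> \<boxtimes> y\<rbrakk> \<Longrightarrow> x \<sqsubseteq> \<boxtimes> \<top>"
    and C4: "x \<in> carrier S \<Longrightarrow> \<boxtimes> x \<sqsubseteq> \<box> (\<boxtimes> x)"
    and C5: "x \<in> carrier S \<Longrightarrow> x \<sqsubseteq> \<top>"

datatype aps_term = Var | Box aps_term | XBox aps_term

primrec eval :: "'a aps_sig \<Rightarrow> aps_term \<Rightarrow> 'a \<Rightarrow> 'a" where
  "eval S Var x = x"
| "eval S (Box t) x = box S (eval S t x)"
| "eval S (XBox t) x = xbox S (eval S t x)"

definition is_fixed_point :: "'a aps_sig \<Rightarrow> aps_term \<Rightarrow> 'a \<Rightarrow> bool" where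
  "is_fixed_point S t p \<longleftrightarrow> p \<in> carrier S \<and> eval S t p = p"

definition E :: "'a aps_sig \<Rightarrow> aps_term \<Rightarrow> bool" where
  "E S t \<longleftrightarrow> (\<exists>p. is_fixed_point S t p)"

definition U :: "'a aps_sig \<Rightarrow> aps_term \<Rightarrow> bool" where
  "U S t \<longleftrightarrow> (\<forall>p q. is_fixed_point S t p \<longrightarrow> is_fixed_point S t q \<longrightarrow> p = q)"

text \<open>\<open>xbox_boxes [k\<^sub>1, \<dots>, k\<^sub>n]\<close> is the term
  \<open>\<boxtimes>\<box>\<^bsup>k\<^sub>1\<^esup> \<boxtimes>\<box>\<^bsup>k\<^sub>2\<^esup> \<dots> \<boxtimes>\<box>\<^bsup>k\<^sub>n\<^esup> v\<close>, with \<open>k\<^sub>1\<close> outermost.\<close>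

primrec xbox_boxes :: "nat list \<Rightarrow> aps_term" where
  "xbox_boxes [] = Var"
| "xbox_boxes (k # ks) = XBox ((Box ^^ k) (xbox_boxes ks))"

end

theory Submission
  imports Defs
begin

text \<open>If \<open>p = \<boxtimes>\<box>\<^sup>kp\<close>, then \<open>p \<sqsubseteq> \<box>p\<close> by C4, hence \<open>p \<sqsubseteq> \<box>(\<box>\<^sup>kp)\<close> and \<open>p \<sqsubseteq> \<boxtimes>(\<box>\<^sup>kp)\<close>,
  so \<open>p \<sqsubseteq> \<boxtimes>\<top>\<close> by C3, while \<open>\<boxtimes>\<top>\<close> lies below every \<open>\<boxtimes>y\<close>; thus \<open>p = \<boxtimes>\<top>\<close>. Consequently, for
  \<open>m \<ge> k\<close> the operation \<open>\<boxtimes>\<box>\<^sup>m\<close> sends everything above \<open>\<boxtimes>\<top>\<close> to \<open>\<boxtimes>\<top>\<close>. A fixed point of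
  \<open>\<triangle>v\<close> lies above \<open>\<boxtimes>\<top>\<close>, so it is mapped to \<open>\<boxtimes>\<top>\<close>.\<close>

lemma eval_Box_funpow: "eval S ((Box ^^ m) t) x = (box S ^^ m) (eval S t x)"
  by (induction m) auto

context aps
begin

lemma trans_le: "\<lbrakk>x \<sqsubseteq> y; y \<sqsubseteq> z; x \<in> carrier S; y \<in> carrier S; z \<in> carrier S\<rbrakk> \<Longrightarrow> x \<sqsubseteq> z"
  using le_trans by (blast dest: transp_onD)

lemma antisym_le: "\<lbrakk>x \<sqsubseteq> y; y \<sqsubseteq> x; x \<in> carrier S; y \<in> carrier S\<rbrakk> \<Longrightarrow> x = y"
  using le_antisym by (blast dest: antisymp_onD)

lemma refl_le: "x \<in> carrier S \<Longrightarrow> x \<sqsubseteq> x"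
  using le_refl by (blast dest: reflp_onD)

lemma box_funpow_closed: "x \<in> carrier S \<Longrightarrow> (box S ^^ m) x \<in> carrier S"
  by (induction m) (auto intro: box_closed)

lemma box_funpow_mono:
  "\<lbrakk>x \<in> carrier S; y \<in> carrier S; x \<sqsubseteq> y\<rbrakk> \<Longrightarrow> (box S ^^ m) x \<sqsubseteq> (box S ^^ m) y"
  by (induction m) (auto intro: C1_box box_funpow_closed)

text \<open>C4 makes every value of \<open>\<boxtimes>\<close> a point that \<open>\<box>\<close>
  raises; monotonicity of \<open>\<box>\<close> lets this be iterated.\<close>

lemma xbox_le_box_funpow:
  assumes "y \<in> carrier S"
  shows "\<boxtimes> y \<sqsubseteq> (box S ^^ m) (\<boxtimes> y)"
proof (induction m)
  case 0
  show ?case using assms by (simp add: refl_le xbox_closed)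
next
  case (Suc m)
  have "\<box> (\<boxtimes> y) \<sqsubseteq> \<box> ((box S ^^ m) (\<boxtimes> y))"
    using Suc assms by (intro C1_box box_funpow_closed xbox_closed)
  with C4[OF assms] show ?case
    using assms by (auto intro: trans_le box_closed box_funpow_closed xbox_closed)
qed

lemma xbox_top_le_xbox: "y \<in> carrier S \<Longrightarrow> \<boxtimes> \<top> \<sqsubseteq> \<boxtimes> y"
  by (simp add: C1_xbox C5 top_closed)

lemma fixed_point_xbox_boxes_eq_xbox_top:
  assumes p: "p \<in> carrier S" and fp: "\<boxtimes> ((box S ^^ k) p) = p"
  shows "p = \<boxtimes> \<top>"
proof (rule antisym_le)
  let ?y = "(box S ^^ k) p"
  have y: "?y \<in> carrier S"
    using p by (rule box_funpow_closed)
  \<comment> \<open>As \<open>p\<close> is itself \<open>\<boxtimes> ?y\<close>, iterated C4 applies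
    to it; \<open>Suc k\<close> boxes on \<open>p\<close> are one box on \<open>?y\<close>.\<close>
  have "p \<sqsubseteq> \<box> ?y"
    using xbox_le_box_funpow[OF y, of "Suc k"] fp by simp
  moreover have "p \<sqsubseteq> \<boxtimes> ?y"
    using refl_le p fp by simp
  ultimately show "p \<sqsubseteq> \<boxtimes> \<top>"
    using C3 p y by blast
  show "\<boxtimes> \<top> \<sqsubseteq> p"
    using xbox_top_le_xbox[OF y] fp by simp
qed (auto intro: p xbox_closed top_closed)

lemma xbox_boxes_collapse:
  assumes fp: "\<boxtimes> ((box S ^^ k) (\<boxtimes> \<top>)) = \<boxtimes> \<top>" and "k \<le> m"
    and x: "x \<in> carrier S" and le: "\<boxtimes> \<top> \<sqsubseteq> x"
  shows "\<boxtimes> ((box S ^^ m) x) = \<boxtimes> \<top>"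
proof (rule antisym_le)
  have t: "\<boxtimes> \<top> \<in> carrier S"
    by (simp add: xbox_closed top_closed)
  note closed = box_funpow_closed xbox_closed t x
  \<comment> \<open>Of the \<open>m\<close> boxes, the inner \<open>m - k\<close> raise
    \<open>\<boxtimes> \<top>\<close> by C4 and the outer \<open>k\<close> preserve the
    order.\<close>
  have "(box S ^^ k) (\<boxtimes> \<top>) \<sqsubseteq> (box S ^^ k) ((box S ^^ (m - k)) (\<boxtimes> \<top>))"
    by (intro box_funpow_mono xbox_le_box_funpow top_closed closed)
  also have "(box S ^^ k) ((box S ^^ (m - k)) (\<boxtimes> \<top>)) = (box S ^^ m) (\<boxtimes> \<top>)"
    using \<open>k \<le> m\<close> by (simp flip: funpow_add comp_apply[of "box S ^^ k"])
  finally have "(box S ^^ k) (\<boxtimes> \<top>) \<sqsubseteq> (box S ^^ m) (\<boxtimes> \<top>)" .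
  moreover have "(box S ^^ m) (\<boxtimes> \<top>) \<sqsubseteq> (box S ^^ m) x"
    by (intro box_funpow_mono closed le)
  ultimately have "(box S ^^ k) (\<boxtimes> \<top>) \<sqsubseteq> (box S ^^ m) x"
    by (rule trans_le) (intro closed)+
  then have "\<boxtimes> ((box S ^^ m) x) \<sqsubseteq> \<boxtimes> ((box S ^^ k) (\<boxtimes> \<top>))"
    by (intro C1_xbox closed)
  then show "\<boxtimes> ((box S ^^ m) x) \<sqsubseteq> \<boxtimes> \<top>"
    by (simp add: fp)
  show "\<boxtimes> \<top> \<sqsubseteq> \<boxtimes> ((box S ^^ m) x)"
    by (intro xbox_top_le_xbox closed)
qed (auto intro: xbox_closed box_funpow_closed top_closed x)

lemma eval_closed: "x \<in> carrier S \<Longrightarrow> eval S t x \<in> carrier S"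
  by (induction t) (auto intro: box_closed xbox_closed)

text \<open>The blocks collapse from the innermost outwards: each receives either \<open>x\<close>
  or \<open>\<boxtimes> \<top>\<close>, both above \<open>\<boxtimes> \<top>\<close>.\<close>

lemma eval_xbox_boxes_eq_xbox_top:
  assumes fp: "\<boxtimes> ((box S ^^ k) (\<boxtimes> \<top>)) = \<boxtimes> \<top>"
    and x: "x \<in> carrier S" and le: "\<boxtimes> \<top> \<sqsubseteq> x"
    and "ks \<noteq> []" and "\<forall>m\<in>set ks. k \<le> m"
  shows "eval S (xbox_boxes ks) x = \<boxtimes> \<top>"
  using assms(4,5)
proof (induction ks)
  case (Cons m ks)
  have "\<boxtimes> \<top> \<sqsubseteq> eval S (xbox_boxes ks) x"
    using Cons le by (cases "ks = []") (auto simp: refl_le xbox_closed top_closed)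
  then show ?case
    using Cons.prems x by (simp add: eval_Box_funpow xbox_boxes_collapse[OF fp] eval_closed)
qed simp

end

theorem theorem5p4:
  fixes S :: "'a aps_sig" and ks :: "nat list" and k :: nat
  assumes "aps S"
    and "length ks \<ge> 1"
    and "k = Min (set ks)"
    and "E S (XBox ((Box ^^ k) Var))"
  shows "E S (xbox_boxes ks) \<and> U S (xbox_boxes ks) \<and>
    is_fixed_point S (xbox_boxes ks) (xbox S (tp S)) \<and>
    (\<forall>p. is_fixed_point S (xbox_boxes ks) p \<longrightarrow> p = xbox S (tp S))"
proof -
  interpret aps S by fact
  let ?t = "xbox S (tp S)"
  have ne: "ks \<noteq> []" and min: "\<forall>m\<in>set ks. k \<le> m"
    using assms(2,3) by auto
  obtain q where q: "q \<in> carrier S" "xbox S ((box S ^^ k) q) = q"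
    using assms(4) by (auto simp: E_def is_fixed_point_def eval_Box_funpow)
  \<comment> \<open>The given fixed point \<open>q\<close> can only be \<open>?t\<close>, so its
    equation is the one that the collapse requires.\<close>
  have fp: "xbox S ((box S ^^ k) ?t) = ?t"
    using q(2) unfolding fixed_point_xbox_boxes_eq_xbox_top[OF q] .
  have t: "?t \<in> carrier S"
    by (simp add: xbox_closed top_closed)
  note collapse = eval_xbox_boxes_eq_xbox_top[OF fp _ _ ne min]
  have fixed: "is_fixed_point S (xbox_boxes ks) ?t"
    using t by (simp add: is_fixed_point_def collapse refl_le)
  have unique: "p = ?t" if "is_fixed_point S (xbox_boxes ks) p" for p
  proof -
    from that have p: "p \<in> carrier S" and eq: "eval S (xbox_boxes ks) p = p"
      by (auto simp: is_fixed_point_def)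
    \<comment> \<open>The outermost symbol of the term is \<open>\<boxtimes>\<close>, so its value
      \<open>p\<close> lies above \<open>?t\<close> and the collapse applies at
      \<open>p\<close>.\<close>
    obtain m ms where "ks = m # ms"
      using ne by (cases ks) auto
    then have "le S ?t (eval S (xbox_boxes ks) p)"
      by (simp add: xbox_top_le_xbox eval_closed p)
    then have "le S ?t p"
      by (simp only: eq)
    then show ?thesis
      using collapse[OF p] eq by simp
  qed
  show ?thesis
    unfolding E_def U_def using fixed unique by metis
qed

end
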